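(* Let $p>3$ be a prime and let $a\in\mathbb Z_p$ with $a(2a+1)\not\equiv 0\pmod p$. Put $t=(a-\langle a\rangle_p)/p$. Then $$\sum_{k=0}^{p-1}\binom ak\binom{-1-a}k\frac 1{2k+1}\equiv \frac{1+2t}{1+2a}+p^2\frac{t(t+1)}{1+2a}B_{p-2}(-a)\equiv \frac{1+2t}{1+2a}+p^2\frac{t(t+1)}{1+2a}\Big(\frac 2{a^2}-B_{p-2}(a)\Big)\pmod{p^3}.$$
   Context: $\mathbb Z_p$ denotes the set of rational numbers whose denominator is not divisible by $p$. For $x,y\in\mathbb Q$, $x\equiv y\pmod{p^m}$ means $(x-y)/p^m\in\mathbb Z_p$. For $a\in\mathbb Z_p$, $\langle a\rangle_p\in\{0,1,\ldots,p-1\}$ is defined by $a\equiv\langle a\rangle_p\pmod p$. For rational $a$ and integer $k\ge0$, $\binom ak=a(a-1)\cdots(a-k+1)/k!$. The Bernoulli numbers are defined by $B_0=1$, $\sum_{k=0}^{n-1}\binom nkB_k=0$ for $n\ge2$, and the Bernoulli polynomials by $B_n(x)=\sum_{k=0}^n\binom nkB_kx^{n-k}$. *)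

theory Defs
  imports Complex_Main "HOL-Computational_Algebra.Primes"
begin

definition Zp :: "nat \<Rightarrow> rat set" where
  "Zp p = {x. \<not> int p dvd snd (quotient_of x)}"

(* cong_pow p m x y stands for x = y (mod p^m) between rational numbers, in the p-adic sense. *)
definition cong_pow :: "nat \<Rightarrow> nat \<Rightarrow> rat \<Rightarrow> rat \<Rightarrow> bool" where
  "cong_pow p m x y \<longleftrightarrow> (x - y) / of_nat p ^ m \<in> Zp p"

(* Meaningful for p prime and a in Zp p only; see ex1_residue below. *)
definition residue :: "nat \<Rightarrow> rat \<Rightarrow> nat" where
  "residue p a = (THE r. r < p \<and> cong_pow p 1 a (of_nat r))"

(* The recurrence sum_{k<n} (n choose k) B_k = 0 (n >= 2) solved for B_{n-1};
   see bernoulli_recurrence below. In this convention B_1 = -1/2. *)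
fun bernoulli :: "nat \<Rightarrow> rat" where
  "bernoulli n = (if n = 0 then 1
     else - (\<Sum>k<n. of_nat (Suc n choose k) * bernoulli k) / of_nat (Suc n))"

declare bernoulli.simps [simp del]

definition bernpoly :: "nat \<Rightarrow> rat \<Rightarrow> rat" where
  "bernpoly n x = (\<Sum>k=0..n. of_nat (n choose k) * bernoulli k * x ^ (n - k))"

lemma bernoulli_0: "bernoulli 0 = 1"
  by (simp add: bernoulli.simps)

lemma bernoulli_recurrence:
  assumes "n \<ge> 2"
  shows "(\<Sum>k=0..n - 1. of_nat (n choose k) * bernoulli k) = 0"
proof -
  obtain m where n: "n = Suc m" and m: "m > 0"
    using assms by (cases n) auto
  have "{0..n - 1} = insert m {..<m}"
    using n by auto
  moreover have "of_nat (Suc m) * bernoulli m = - (\<Sum>k<m. of_nat (Suc m choose k) * bernoulli k)"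
    using m by (subst bernoulli.simps) (simp del: of_nat_Suc)
  ultimately show ?thesis
    using n by (simp del: of_nat_Suc)
qed

lemma Zp_iff:
  assumes "prime p"
  shows "x \<in> Zp p \<longleftrightarrow> (\<exists>u v. \<not> int p dvd v \<and> x = of_int u / of_int v)"
proof
  assume x: "x \<in> Zp p"
  obtain u v where uv: "quotient_of x = (u, v)" by (cases "quotient_of x")
  show "\<exists>u v. \<not> int p dvd v \<and> x = of_int u / of_int v"
    using x uv quotient_of_div[OF uv] unfolding Zp_def by auto
next
  assume "\<exists>u v. \<not> int p dvd v \<and> x = of_int u / of_int v"
  then obtain u v where v: "\<not> int p dvd v" and x: "x = of_int u / of_int v" by blast
  obtain c d where cd: "quotient_of x = (c, d)" by (cases "quotient_of x")
  have d: "d > 0" and cop: "coprime c d" and x': "x = of_int c / of_int d"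
    using quotient_of_denom_pos[OF cd] quotient_of_coprime[OF cd] quotient_of_div[OF cd] by auto
  have "v \<noteq> 0" using v by auto
  hence "rat_of_int (u * d) = rat_of_int (c * v)"
    using x x' d by (simp add: field_simps)
  hence "u * d = c * v" by (simp only: of_int_eq_iff)
  hence "d dvd c * v" by (metis dvd_triv_right)
  hence "d dvd v" using cop by (simp add: coprime_dvd_mult_right_iff coprime_commute)
  hence "\<not> int p dvd d" using v dvd_trans by blast
  thus "x \<in> Zp p" using cd by (simp add: Zp_def)
qed

lemma ex1_residue:
  assumes p: "prime p" and a: "a \<in> Zp p"
  shows "\<exists>!r. r < p \<and> cong_pow p 1 a (of_nat r)"
proof -
  have p0: "p > 0" using p by (simp add: prime_gt_0_nat)
  have pp: "prime (int p)" using p by simp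
  obtain u v where v: "\<not> int p dvd v" and auv: "a = of_int u / of_int v"
    using a Zp_iff[OF p] by blast
  have v0: "v \<noteq> 0" using v by auto
  have cong: "cong_pow p 1 a (of_nat r) \<longleftrightarrow> int p dvd u - int r * v" for r
  proof
    assume "int p dvd u - int r * v"
    then obtain k where k: "u - int r * v = int p * k" by (elim dvdE)
    have "rat_of_int u - of_nat r * of_int v = of_nat p * of_int k"
      using arg_cong[OF k, of rat_of_int] by simp
    hence "(a - of_nat r) / of_nat p ^ 1 = of_int k / of_int v"
      using v0 p0 auv by (simp add: field_simps)
    thus "cong_pow p 1 a (of_nat r)"
      unfolding cong_pow_def Zp_iff[OF p] using v by blast
  next
    assume "cong_pow p 1 a (of_nat r)"
    then obtain c d where d: "\<not> int p dvd d"
      and eq: "(a - of_nat r) / of_nat p ^ 1 = of_int c / of_int d"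
      unfolding cong_pow_def Zp_iff[OF p] by blast
    have d0: "d \<noteq> 0" using d by auto
    have "rat_of_int ((u - int r * v) * d) = rat_of_int (int p * (c * v))"
      using eq v0 d0 p0 auv by (simp add: field_simps)
    hence "(u - int r * v) * d = int p * (c * v)" by (simp only: of_int_eq_iff)
    hence "int p dvd (u - int r * v) * d" by simp
    thus "int p dvd u - int r * v" using d pp by (simp add: prime_dvd_mult_iff)
  qed
  show ?thesis
  proof (rule ex_ex1I)
    have "coprime v (int p)"
      using v pp by (metis coprime_commute prime_imp_coprime)
    then obtain w z where wz: "w * v + z * int p = 1"
      by (metis bezout_int coprime_imp_gcd_eq_1)
    define r where "r = nat ((u * w) mod int p)"
    have r: "int r = (u * w) mod int p" using p0 by (simp add: r_def)
    have "int r < int p" using p0 by (simp add: r)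
    moreover have "int p dvd u - int r * v"
    proof -
      obtain q where "u * w = int r + int p * q"
        using r by (metis mod_mult_div_eq)
      hence q: "int r = u * w - int p * q" by simp
      have "u - int r * v = u * (1 - w * v) + int p * q * v"
        unfolding q by (simp add: algebra_simps)
      also have "1 - w * v = z * int p" using wz by simp
      finally show ?thesis by simp
    qed
    ultimately show "\<exists>r. r < p \<and> cong_pow p 1 a (of_nat r)"
      using cong by auto
  next
    fix r s
    assume r: "r < p \<and> cong_pow p 1 a (of_nat r)" and s: "s < p \<and> cong_pow p 1 a (of_nat s)"
    have "int p dvd (u - int s * v) - (u - int r * v)"
      by (rule dvd_diff) (use r s cong in auto)
    also have "(u - int s * v) - (u - int r * v) = (int r - int s) * v"
      by (simp add: algebra_simps)
    finally have "int p dvd int r - int s"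
      using v pp by (simp add: prime_dvd_mult_iff)
    hence "int r mod int p = int s mod int p" by (simp add: mod_eq_dvd_iff)
    thus "r = s" using r s by simp
  qed
qed

end

theory Submission
  imports Defs "HOL-Computational_Algebra.Formal_Power_Series" "HOL-Number_Theory.Residues"
begin

text \<open>
  Let \<open>f a\<close> be \<open>2 * a + 1\<close> times the sum in question. A telescoping argument gives
  \<open>f a - f (a - 1) = 2 * P a\<close> with \<open>P a = (\<Prod>i=1..p-1. 1 - (a / i)\<^sup>2)\<close>. Modulo \<open>p ^ 3\<close>,
  \<open>P (p * s + j)\<close> is \<open>p\<^sup>2 * s * (s + 1) / j\<^sup>2\<close> for \<open>0 < j < p\<close>, and it is \<open>1\<close> for \<open>j = 0\<close>, because
  \<open>\<Sum>i=1..p-1. 1 / i\<^sup>2\<close> vanishes modulo \<open>p\<close>. Hence \<open>f (p * n)\<close> is \<open>1 + 2 * n\<close> for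
  natural \<open>n\<close>, and by \<open>p\<close>-adic continuity \<open>f (p * t)\<close> is \<open>1 + 2 * t\<close>. Climbing from \<open>p * t\<close> to
  \<open>a = p * t + r\<close> adds \<open>2 * p\<^sup>2 * t * (t + 1) * (\<Sum>i=1..r. 1 / i\<^sup>2)\<close>. By Fermat and the difference
  equation of the Bernoulli polynomials, \<open>2 * (\<Sum>i=1..r. 1 / i\<^sup>2)\<close> is \<open>B (- r)\<close>, thus \<open>B (- a)\<close>,
  modulo \<open>p\<close>, where \<open>B\<close> has index \<open>p - 2\<close>. The second congruence is the reflection formula.
\<close>

section \<open>Bernoulli polynomials\<close>

unbundle fps_syntax

text \<open>The exponential generating function \<open>X / (exp X - 1)\<close>, given by its
  coefficients; the next lemma identifies it in a form free of division.\<close>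

definition bernoulli_fps :: "rat fps" where
  "bernoulli_fps = Abs_fps (\<lambda>n. bernoulli n / fact n)"

text \<open>The coefficient at \<open>n\<close> is the sum in \<open>bernoulli_recurrence\<close>
  divided by \<open>fact n\<close>, so it vanishes for \<open>n \<ge> 2\<close>.\<close>

lemma bernoulli_fps_times_exp_minus_1: "bernoulli_fps * (fps_exp 1 - 1) = fps_X"
proof (rule fps_ext)
  fix n
  have "(bernoulli_fps * (fps_exp 1 - 1)) $ n
      = (\<Sum>i=0..n. bernoulli i / fact i * (if i = n then 0 else 1 / fact (n - i)))"
    unfolding fps_mult_nth bernoulli_fps_def by (intro sum.cong) auto
  also have "\<dots> = (\<Sum>i\<in>{0..<n}. bernoulli i / fact i * (1 / fact (n - i)))"
    by (intro sum.mono_neutral_cong_right) auto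
  also have "\<dots> = (\<Sum>i\<in>{0..<n}. of_nat (n choose i) * bernoulli i / fact n)"
    by (intro sum.cong) (auto simp: binomial_fact field_simps)
  also have "\<dots> = fps_X $ n"
  proof (cases "n \<ge> 2")
    case True
    then have "{0..<n} = {0..n - 1}" by auto
    with bernoulli_recurrence[OF True] True show ?thesis
      by (simp add: sum_divide_distrib[symmetric])
  next
    case False
    then have "n = 0 \<or> n = 1" by auto
    then show ?thesis by (auto simp: bernoulli_0)
  qed
  finally show "(bernoulli_fps * (fps_exp 1 - 1)) $ n = fps_X $ n" .
qed

lemma bernpoly_egf: "fact n * (bernoulli_fps * fps_exp x) $ n = bernpoly n x"
  unfolding fps_mult_nth bernoulli_fps_def bernpoly_def sum_distrib_left
  by (intro sum.cong) (auto simp: binomial_fact field_simps)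

text \<open>On generating functions, passing from \<open>x\<close> to \<open>x + 1\<close>
  multiplies by \<open>fps_exp 1\<close>, so the difference has the factor
  \<open>fps_exp 1 - 1\<close>, which turns \<open>bernoulli_fps\<close> into
  \<open>fps_X\<close>.\<close>

lemma bernpoly_diff:
  assumes "n > 0"
  shows "bernpoly n (x + 1) - bernpoly n x = of_nat n * x ^ (n - 1)"
proof -
  obtain m where n: "n = Suc m" using assms gr0_conv_Suc by blast
  have "bernoulli_fps * fps_exp (x + 1) - bernoulli_fps * fps_exp x
      = (bernoulli_fps * (fps_exp 1 - 1)) * fps_exp x"
    by (simp add: fps_exp_add_mult algebra_simps)
  also have "\<dots> = fps_X * fps_exp x"
    by (simp only: bernoulli_fps_times_exp_minus_1)
  finally have "(bernoulli_fps * fps_exp (x + 1) - bernoulli_fps * fps_exp x) $ n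
      = (fps_X * fps_exp x) $ n" by simp
  then have "bernpoly n (x + 1) - bernpoly n x = fact n * (fps_X * fps_exp x) $ n"
    unfolding bernpoly_egf[symmetric] fps_sub_nth by (simp only: right_diff_distrib[symmetric])
  then show ?thesis by (simp add: n fact_Suc del: of_nat_Suc)
qed

text \<open>Formally, \<open>- X / (exp (- X) - 1) = X * exp X / (exp X - 1)\<close>. Instead of
  dividing, both sides are multiplied by the nonzero series \<open>1 - fps_exp 1\<close>, which is
  then cancelled.\<close>

lemma bernoulli_fps_reflect: "bernoulli_fps oo (- fps_X) = bernoulli_fps * fps_exp 1"
proof -
  have "(bernoulli_fps * (fps_exp 1 - 1)) oo (- fps_X) = fps_X oo (- fps_X)"
    by (simp only: bernoulli_fps_times_exp_minus_1)
  moreover have "(fps_exp 1 oo (- fps_X)) = (fps_exp (- 1) :: rat fps)"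
    by (simp add: fps_compose_uminus' fps_eq_iff)
  ultimately have *: "(bernoulli_fps oo (- fps_X)) * (fps_exp (- 1) - 1) = - fps_X"
    by (simp add: fps_compose_mult_distrib fps_compose_sub_distrib)
  have e: "fps_exp (- 1) * fps_exp 1 = (1 :: rat fps)"
    by (simp flip: fps_exp_add_mult)
  have "(bernoulli_fps oo (- fps_X)) * (1 - fps_exp 1)
      = (bernoulli_fps oo (- fps_X)) * (fps_exp (- 1) * fps_exp 1 - fps_exp 1)"
    by (simp only: e)
  also have "\<dots> = (bernoulli_fps oo (- fps_X)) * (fps_exp (- 1) - 1) * fps_exp 1"
    by (simp only: left_diff_distrib mult_1 mult.assoc)
  also have "\<dots> = - fps_X * fps_exp 1"
    by (simp only: *)
  also have "\<dots> = (bernoulli_fps * fps_exp 1) * (1 - fps_exp 1)"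
    by (simp flip: bernoulli_fps_times_exp_minus_1 add: algebra_simps)
  finally have "(bernoulli_fps oo (- fps_X)) * (1 - fps_exp 1)
      = (bernoulli_fps * fps_exp 1) * (1 - fps_exp 1)" .
  moreover have "(1 - fps_exp 1 :: rat fps) \<noteq> 0"
  proof
    assume "(1 - fps_exp 1 :: rat fps) = 0"
    then have "(1 - fps_exp 1 :: rat fps) $ 1 = 0" by simp
    then show False by simp
  qed
  ultimately show ?thesis by simp
qed

lemma bernpoly_reflect: "bernpoly n (- x) = (- 1) ^ n * bernpoly n (x + 1)"
proof -
  have "(bernoulli_fps * fps_exp (- x)) oo (- fps_X)
      = (bernoulli_fps oo (- fps_X)) * (fps_exp (- x) oo (- fps_X))"
    by (simp add: fps_compose_mult_distrib)
  also have "fps_exp (- x) oo (- fps_X) = fps_exp x"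
    by (simp add: fps_compose_uminus' fps_eq_iff power_minus[of x])
  also have "(bernoulli_fps oo (- fps_X)) * fps_exp x = bernoulli_fps * fps_exp (x + 1)"
    by (simp add: bernoulli_fps_reflect fps_exp_add_mult mult_ac)
  finally have "((bernoulli_fps * fps_exp (- x)) oo (- fps_X)) $ n
      = (bernoulli_fps * fps_exp (x + 1)) $ n" by simp
  then have "(- 1) ^ n * bernpoly n (- x) = bernpoly n (x + 1)"
    by (simp add: fps_compose_uminus' bernpoly_egf[symmetric])
  then have "(- 1) ^ n * bernpoly n (x + 1) = (- 1) ^ n * ((- 1) ^ n * bernpoly n (- x))"
    by simp
  also have "\<dots> = bernpoly n (- x)"
    by (rule left_minus_one_mult_self)
  finally show ?thesis by simp
qed

text \<open>Reflection gives \<open>B(0) = - B(1)\<close>, while the difference equation gives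
  \<open>B(1) = B(0)\<close> because \<open>0 ^ (n - 1) = 0\<close> for
  \<open>n > 1\<close>.\<close>

lemma bernpoly_odd_0:
  assumes "odd n" "n > 1"
  shows "bernpoly n 0 = 0"
  using bernpoly_reflect[of n 0] bernpoly_diff[of n 0] assms by (simp add: power_0_left)

text \<open>The difference equation is summed downwards from \<open>0\<close>; the signs disappear
  because \<open>n - 1\<close> is even.\<close>

lemma bernpoly_minus_nat:
  assumes "odd n" "n > 1"
  shows "bernpoly n (- of_nat r) = - of_nat n * (\<Sum>i=1..r. of_nat i ^ (n - 1))"
proof (induction r)
  case 0
  then show ?case using bernpoly_odd_0[OF assms] by simp
next
  case (Suc r)
  have "bernpoly n (- of_nat (Suc r) + 1) - bernpoly n (- of_nat (Suc r))
      = of_nat n * (- of_nat (Suc r)) ^ (n - 1)"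
    using assms by (intro bernpoly_diff) auto
  moreover have "(- of_nat (Suc r) :: rat) ^ (n - 1) = of_nat (Suc r) ^ (n - 1)"
    using assms by (intro power_minus_even) auto
  moreover have "- of_nat (Suc r) + 1 = (- of_nat r :: rat)" by simp
  ultimately have "bernpoly n (- of_nat (Suc r))
      = bernpoly n (- of_nat r) - of_nat n * of_nat (Suc r) ^ (n - 1)" by simp
  then show ?case unfolding Suc.IH by (simp add: algebra_simps del: of_nat_Suc)
qed

section \<open>Binomial identities\<close>

text \<open>This and the next lemma extract the same quotient
  \<open>(x - 1 gchoose n) / of_nat (Suc n)\<close>. With that quotient treated as an atom, the
  identities below become polynomial ones.\<close>

lemma gbinomial_absorption_div:
  fixes x :: "'a :: field_char_0"
  shows "(x gchoose Suc n) = x * ((x - 1 gchoose n) / of_nat (Suc n))"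
  using gbinomial_factors[of "x - 1" n] by simp

lemma gbinomial_Suc_div:
  fixes x :: "'a :: field_char_0"
  shows "(x - 1 gchoose Suc n) = (x - of_nat (Suc n)) * ((x - 1 gchoose n) / of_nat (Suc n))"
proof -
  have "(of_nat (Suc n) :: 'a) \<noteq> 0" by (simp del: of_nat_Suc)
  moreover have "of_nat (Suc n) * (x - 1 gchoose Suc n) = (x - of_nat (Suc n)) * (x - 1 gchoose n)"
    using gbinomial_mult_1[of "x - 1" n] by (simp add: algebra_simps)
  ultimately show ?thesis by (simp add: field_simps del: of_nat_Suc)
qed

text \<open>The factor \<open>2 * k + 1\<close> on the right cancels the denominator in the sum. For
  \<open>k > 0\<close>, with \<open>s = k\<close> and the common factors \<open>u * v\<close>
  removed, this is an identity between polynomials in \<open>a\<close> and \<open>s\<close>.\<close>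

lemma gbinomial_recurrence_term:
  fixes a :: "'a :: field_char_0"
  shows "(2 * a + 1) * ((a gchoose k) * (- 1 - a gchoose k))
       - (2 * a - 1) * ((a - 1 gchoose k) * (- a gchoose k))
       = 2 * of_nat (2 * k + 1) * ((a gchoose k) * (- a gchoose k))"
proof (cases k)
  case 0
  then show ?thesis by simp
next
  case (Suc m)
  define s :: 'a where "s = of_nat (Suc m)"
  define u v where "u = (a - 1 gchoose m) / s" and "v = (- a - 1 gchoose m) / s"
  have k: "of_nat (2 * k + 1) = 2 * s + 1" and neg: "- 1 - a = - a - 1"
    by (simp_all add: Suc s_def)
  show ?thesis
    unfolding neg k
    unfolding Suc gbinomial_absorption_div[of a] gbinomial_absorption_div[of "- a"]
      gbinomial_Suc_div s_def[symmetric] u_def[symmetric] v_def[symmetric]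
    by (simp add: algebra_simps)
qed

lemma gbinomial_times_gbinomial_minus:
  fixes a :: "'a :: field_char_0"
  shows "(a - 1 gchoose n) * (- a - 1 gchoose n) = (\<Prod>i=1..n. 1 - (a / of_nat i)\<^sup>2)"
proof (induction n)
  case (Suc n)
  define s :: 'a where "s = of_nat (Suc n)"
  have "s \<noteq> 0" by (simp add: s_def del: of_nat_Suc)
  then have "(a - s) * (u / s) * ((- a - s) * (v / s)) = u * v * (1 - (a / s)\<^sup>2)" for u v
    by (simp add: field_simps power2_eq_square)
  then have "(a - 1 gchoose Suc n) * (- a - 1 gchoose Suc n)
      = (a - 1 gchoose n) * (- a - 1 gchoose n) * (1 - (a / s)\<^sup>2)"
    unfolding gbinomial_Suc_div s_def by blast
  then show ?case using Suc.IH by (simp add: s_def del: of_nat_Suc)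
qed simp

text \<open>Adding the term at \<open>Suc n\<close> multiplies the closed form by
  \<open>1 - (a / s) ^ 2\<close> with \<open>s = Suc n\<close>, as \<open>u * v\<close> and
  \<open>a * (u / s) * (- a * (v / s))\<close> have a common factor.\<close>

lemma sum_gbinomial_minus:
  fixes a :: "'a :: field_char_0"
  shows "(\<Sum>k=0..n. (a gchoose k) * (- a gchoose k)) = (a - 1 gchoose n) * (- a - 1 gchoose n)"
proof (induction n)
  case (Suc n)
  define s :: 'a where "s = of_nat (Suc n)"
  have "s \<noteq> 0" by (simp add: s_def del: of_nat_Suc)
  then have "u * v + a * (u / s) * (- a * (v / s)) = (a - s) * (u / s) * ((- a - s) * (v / s))" for u v
    by (simp add: field_simps)
  then have "(a - 1 gchoose n) * (- a - 1 gchoose n) + (a gchoose Suc n) * (- a gchoose Suc n)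
      = (a - 1 gchoose Suc n) * (- a - 1 gchoose Suc n)"
    unfolding gbinomial_Suc_div gbinomial_absorption_div[of a] gbinomial_absorption_div[of "- a"] s_def
    by blast
  then show ?case using Suc.IH by simp
qed simp

text \<open>This is \<open>f\<close> of the overview; the factor \<open>2 * a + 1\<close> is what
  makes the difference in \<open>a\<close> free of the denominators
  \<open>2 * k + 1\<close>.\<close>

definition scaled_sum :: "nat \<Rightarrow> rat \<Rightarrow> rat" where
  "scaled_sum p a = (2 * a + 1) *
     (\<Sum>k=0..p - 1. (a gchoose k) * ((- 1 - a) gchoose k) * (1 / of_nat (2 * k + 1)))"

lemma scaled_sum_diff: "scaled_sum p a - scaled_sum p (a - 1) = 2 * (\<Prod>i=1..p - 1. 1 - (a / of_nat i)\<^sup>2)"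
proof -
  have "scaled_sum p a - scaled_sum p (a - 1) = (\<Sum>k=0..p - 1.
      ((2 * a + 1) * ((a gchoose k) * (- 1 - a gchoose k))
       - (2 * a - 1) * ((a - 1 gchoose k) * (- a gchoose k))) / of_nat (2 * k + 1))"
    by (simp add: scaled_sum_def sum_distrib_left sum_subtractf[symmetric] diff_divide_distrib
        mult.assoc del: of_nat_add of_nat_mult of_nat_Suc)
  also have "\<dots> = (\<Sum>k=0..p - 1. 2 * ((a gchoose k) * (- a gchoose k)))"
    unfolding gbinomial_recurrence_term
    by (intro sum.cong refl) (simp del: of_nat_add of_nat_mult of_nat_Suc add: of_nat_eq_0_iff)
  also have "\<dots> = 2 * (\<Prod>i=1..p - 1. 1 - (a / of_nat i)\<^sup>2)"
    by (simp only: sum_gbinomial_minus gbinomial_times_gbinomial_minus sum_distrib_left[symmetric])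
  finally show ?thesis .
qed

lemma prod_one_minus_div:
  fixes x :: "'a :: field_char_0"
  shows "(\<Prod>i=1..n. 1 - x / of_nat i) = (- 1) ^ n * (x - 1 gchoose n)"
proof (induction n)
  case (Suc n)
  have "(of_nat (Suc n) :: 'a) \<noteq> 0" by (simp del: of_nat_Suc)
  then have "(x - 1 gchoose Suc n) = - (x - 1 gchoose n) * (1 - x / of_nat (Suc n))"
    unfolding gbinomial_Suc_div by (simp add: field_simps del: of_nat_Suc)
  then show ?case using Suc.IH by (simp del: of_nat_Suc)
qed simp

text \<open>Up to sign, the factors are \<open>1 / (M choose j)\<close> and \<open>M choose j\<close>.\<close>
lemma prod_one_minus_div_delete:
  assumes "1 \<le> j" "j \<le> M"
  shows "(\<Prod>i\<in>{1..M} - {j}. 1 - of_nat j / of_nat i) *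
         (\<Prod>i=1..j. 1 - of_nat (M + 1) / of_nat i) = (- 1 :: 'a :: field_char_0)"
proof -
  have binom: "(\<Prod>i=1..j. 1 - of_nat (M + 1) / of_nat i) = ((- 1) ^ j * of_nat (M choose j) :: 'a)" for M
    by (subst prod_one_minus_div) (simp add: binomial_gbinomial)
  \<comment> \<open>Induction starts at \<open>M = j\<close>, where the deleted index is the last
    one. Each step multiplies the product by \<open>1 - j / (M + 1)\<close> and the binomial
    coefficient by the inverse of this.\<close>
  have "(\<Prod>i\<in>{1..M} - {j}. 1 - of_nat j / of_nat i) * of_nat (M choose j) = ((- 1) ^ (j - 1) :: 'a)"
    using \<open>j \<le> M\<close>
  proof (induction M rule: dec_induct)
    case base
    have "{1..j} - {j} = {1..j - 1}" by auto
    then have "(\<Prod>i\<in>{1..j} - {j}. 1 - of_nat j / of_nat i) = ((- 1) ^ (j - 1) * (of_nat j - 1 gchoose (j - 1)) :: 'a)"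
      by (simp only: prod_one_minus_div)
    also have "(of_nat j - 1 :: 'a) = of_nat (j - 1)"
      using assms by (simp add: of_nat_diff)
    finally show ?case by (simp flip: binomial_gbinomial)
  next
    case (step M)
    have s0: "(of_nat (Suc M) :: 'a) \<noteq> 0" by (simp del: of_nat_Suc)
    have "{1..Suc M} - {j} = insert (Suc M) ({1..M} - {j})"
      using step by auto
    then have 1: "(\<Prod>i\<in>{1..Suc M} - {j}. 1 - of_nat j / of_nat i)
        = (1 - of_nat j / of_nat (Suc M)) * (\<Prod>i\<in>{1..M} - {j}. 1 - of_nat j / of_nat i :: 'a)"
      by (simp del: of_nat_Suc)
    have "(Suc M - j) * (Suc M choose j) = Suc M * (M choose j)"
      using binomial_absorb_comp[of "Suc M" j] by (simp only: diff_Suc_1)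
    then have "(of_nat (Suc M - j) * of_nat (Suc M choose j) :: 'a) = of_nat (Suc M) * of_nat (M choose j)"
      by (simp only: of_nat_mult[symmetric])
    also have "of_nat (Suc M - j) = (of_nat (Suc M) - of_nat j :: 'a)"
      using step by (simp only: of_nat_diff)
    finally have 2: "(1 - of_nat j / of_nat (Suc M)) * of_nat (Suc M choose j) = (of_nat (M choose j) :: 'a)"
      using s0 by (simp add: field_simps del: of_nat_Suc binomial_Suc_Suc)
    show ?case unfolding 1 step.IH[symmetric] 2[symmetric] by (simp only: mult_ac)
  qed
  then have "(\<Prod>i\<in>{1..M} - {j}. 1 - of_nat j / of_nat i) * ((- 1) ^ j * of_nat (M choose j))
      = ((- 1) ^ j * (- 1) ^ (j - 1) :: 'a)"
    by (simp add: mult_ac)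
  also have "\<dots> = - 1"
    using assms by (cases j) (simp_all flip: power_mult_distrib)
  finally show ?thesis by (simp only: binom)
qed

section \<open>Congruences between rational numbers\<close>

lemma cong_powI: "prime p \<Longrightarrow> z \<in> Zp p \<Longrightarrow> x - y = of_nat p ^ m * z \<Longrightarrow> cong_pow p m x y"
  using prime_gt_0_nat[of p] by (simp add: cong_pow_def)

lemma cong_powE:
  assumes "prime p" "cong_pow p m x y"
  obtains z where "z \<in> Zp p" "x = y + of_nat p ^ m * z"
proof -
  have "x = y + of_nat p ^ m * ((x - y) / of_nat p ^ m)"
    using prime_gt_0_nat[OF assms(1)] by simp
  then show thesis using assms(2) that unfolding cong_pow_def by blast
qed

context
  fixes p :: nat
  assumes prime: "prime p"
begin

section \<open>Ring structure and units of \<open>Zp p\<close>\<close>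

lemma Zp_of_int [simp, intro]: "of_int n \<in> Zp p"
  unfolding Zp_iff[OF prime] using prime_gt_1_nat[OF prime]
  by (intro exI[of _ n] exI[of _ 1]) auto

lemma Zp_of_nat [simp, intro]: "of_nat n \<in> Zp p"
  using Zp_of_int[of "int n"] by simp

lemma Zp_numeral [simp, intro]: "numeral n \<in> Zp p" "0 \<in> Zp p" "1 \<in> Zp p"
  using Zp_of_nat[of "numeral n"] Zp_of_nat[of 0] Zp_of_nat[of 1] by simp_all

lemma Zp_add [simp, intro]: "x + y \<in> Zp p" if xy: "x \<in> Zp p" "y \<in> Zp p"
proof -
  obtain a b c d where *: "\<not> int p dvd b" "\<not> int p dvd d" "x = of_int a / of_int b" "y = of_int c / of_int d"
    using xy unfolding Zp_iff[OF prime] by blast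
  have "b \<noteq> 0" "d \<noteq> 0" using * by auto
  then have "x + y = of_int (a * d + c * b) / of_int (b * d)" by (simp add: * field_simps)
  moreover have "\<not> int p dvd b * d" using * prime by (simp add: prime_dvd_mult_iff)
  ultimately show ?thesis unfolding Zp_iff[OF prime] by blast
qed

lemma Zp_mult [simp, intro]: "x * y \<in> Zp p" if xy: "x \<in> Zp p" "y \<in> Zp p"
proof -
  obtain a b c d where *: "\<not> int p dvd b" "\<not> int p dvd d" "x = of_int a / of_int b" "y = of_int c / of_int d"
    using xy unfolding Zp_iff[OF prime] by blast
  have "x * y = of_int (a * c) / of_int (b * d)" by (simp add: *)
  moreover have "\<not> int p dvd b * d" using * prime by (simp add: prime_dvd_mult_iff)
  ultimately show ?thesis unfolding Zp_iff[OF prime] by blast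
qed

lemma Zp_uminus [simp, intro]: "- x \<in> Zp p" if "x \<in> Zp p"
  using Zp_mult[OF Zp_of_int[of "- 1"] that] by simp

lemma Zp_diff [simp, intro]: "x - y \<in> Zp p" if "x \<in> Zp p" "y \<in> Zp p"
  using Zp_add[OF that(1) Zp_uminus[OF that(2)]] by simp

lemma Zp_power [simp, intro]: "x ^ n \<in> Zp p" if "x \<in> Zp p"
  using that by (induction n) auto

lemma Zp_sum: "(\<And>i. i \<in> A \<Longrightarrow> f i \<in> Zp p) \<Longrightarrow> sum f A \<in> Zp p"
  by (induction A rule: infinite_finite_induct) auto

lemma Zp_prod: "(\<And>i. i \<in> A \<Longrightarrow> f i \<in> Zp p) \<Longrightarrow> prod f A \<in> Zp p"
  by (induction A rule: infinite_finite_induct) auto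

lemma Zp_inverse:
  assumes "x \<in> Zp p" "\<not> cong_pow p 1 x 0"
  shows "1 / x \<in> Zp p"
proof -
  obtain u v where uv: "\<not> int p dvd v" "x = of_int u / of_int v"
    using assms(1) unfolding Zp_iff[OF prime] by blast
  have "\<not> int p dvd u"
  proof
    assume "int p dvd u"
    then obtain w where "u = int p * w" by (elim dvdE)
    then have "(x - 0) / of_nat p ^ 1 = of_int w / of_int v"
      using prime_gt_0_nat[OF prime] by (simp add: uv)
    then show False using assms(2) uv(1) unfolding cong_pow_def Zp_iff[OF prime] by blast
  qed
  moreover have "1 / x = of_int v / of_int u" by (simp add: uv)
  ultimately show ?thesis unfolding Zp_iff[OF prime] by blast
qed

lemma cong_pow_of_nat_0_iff: "cong_pow p 1 (of_nat n) 0 \<longleftrightarrow> p dvd n"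
proof
  assume "p dvd n"
  then obtain w where "n = p * w" by (elim dvdE)
  then show "cong_pow p 1 (of_nat n) 0"
    by (intro cong_powI[OF prime, of "of_nat w"]) auto
next
  assume "cong_pow p 1 (of_nat n) 0"
  then obtain z where "z \<in> Zp p" and n: "of_nat n = of_nat p * z"
    using cong_powE[OF prime] by (metis add_0 power_one_right)
  then obtain u v where uv: "\<not> int p dvd v" "z = of_int u / of_int v"
    unfolding Zp_iff[OF prime] by blast
  have "v \<noteq> 0" using uv by auto
  then have "rat_of_int (int n * v) = of_int (int p * u)"
    using n uv by (simp add: field_simps)
  then have "int n * v = int p * u" by (simp only: of_int_eq_iff)
  then have "int p dvd int n * v" by simp
  then show "p dvd n" using uv(1) prime by (simp add: prime_dvd_mult_iff)
qed

lemma Zp_inverse_nat: "1 / of_nat n \<in> Zp p" if "\<not> p dvd n"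
  using that by (intro Zp_inverse) (auto simp: cong_pow_of_nat_0_iff simp del: One_nat_def)

lemma Zp_inverse_nat_less: "1 / of_nat n \<in> Zp p" if "0 < n" "n < p"
  using that by (intro Zp_inverse_nat) (simp add: nat_dvd_not_less)

lemma Zp_divide_nat_less: "x / of_nat n \<in> Zp p" if "x \<in> Zp p" "0 < n" "n < p"
  using Zp_mult[OF that(1) Zp_inverse_nat_less[OF that(2,3)]] by simp

section \<open>Arithmetic of congruences\<close>

lemma cong_pow_refl [simp]: "cong_pow p m x x"
  by (rule cong_powI[OF prime, of 0]) auto

lemma cong_pow_sym: "cong_pow p m y x" if h: "cong_pow p m x y"
proof -
  obtain z where "z \<in> Zp p" "x = y + of_nat p ^ m * z" using cong_powE[OF prime h] .
  then show ?thesis by (intro cong_powI[OF prime, of "- z"]) auto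
qed

lemma cong_pow_trans [trans]: "cong_pow p m x z" if h: "cong_pow p m x y" "cong_pow p m y z"
proof -
  obtain u where u: "u \<in> Zp p" "x = y + of_nat p ^ m * u" using cong_powE[OF prime h(1)] .
  obtain v where v: "v \<in> Zp p" "y = z + of_nat p ^ m * v" using cong_powE[OF prime h(2)] .
  show ?thesis using u v by (intro cong_powI[OF prime, of "u + v"]) (auto simp: algebra_simps)
qed

lemma cong_pow_add: "cong_pow p m (x + x') (y + y')" if h: "cong_pow p m x y" "cong_pow p m x' y'"
proof -
  obtain u where u: "u \<in> Zp p" "x = y + of_nat p ^ m * u" using cong_powE[OF prime h(1)] .
  obtain v where v: "v \<in> Zp p" "x' = y' + of_nat p ^ m * v" using cong_powE[OF prime h(2)] .
  show ?thesis using u v by (intro cong_powI[OF prime, of "u + v"]) (auto simp: algebra_simps)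
qed

lemma cong_pow_mult:
  assumes "cong_pow p m x y" "cong_pow p m x' y'" "y \<in> Zp p" "y' \<in> Zp p"
  shows "cong_pow p m (x * x') (y * y')"
proof -
  obtain u where u: "u \<in> Zp p" "x = y + of_nat p ^ m * u" using cong_powE[OF prime assms(1)] .
  obtain v where v: "v \<in> Zp p" "x' = y' + of_nat p ^ m * v" using cong_powE[OF prime assms(2)] .
  show ?thesis using u v assms(3,4)
    by (intro cong_powI[OF prime, of "u * y' + v * y + of_nat p ^ m * u * v"]) (auto simp: algebra_simps)
qed

lemma cong_pow_cmult: "cong_pow p m (c * x) (c * y)" if h: "cong_pow p m x y" "c \<in> Zp p"
proof -
  obtain u where u: "u \<in> Zp p" "x = y + of_nat p ^ m * u" using cong_powE[OF prime h(1)] .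
  show ?thesis using u h(2)
    by (intro cong_powI[OF prime, of "c * u"]) (auto simp: algebra_simps)
qed

lemma cong_pow_uminus: "cong_pow p m (- x) (- y)" if "cong_pow p m x y"
  using cong_pow_cmult[OF that, of "- 1"] by simp

lemma cong_pow_diff: "cong_pow p m (x - x') (y - y')" if "cong_pow p m x y" "cong_pow p m x' y'"
  using cong_pow_add[OF that(1) cong_pow_uminus[OF that(2)]] by simp

text \<open>A factor \<open>p ^ 2\<close> in front lifts what is known modulo \<open>p\<close> about
  sums of inverse squares to modulus \<open>p ^ 3\<close>.\<close>

lemma cong_pow_scale: "cong_pow p (k + m) (of_nat p ^ k * x) (of_nat p ^ k * y)" if h: "cong_pow p m x y"
proof -
  obtain u where u: "u \<in> Zp p" "x = y + of_nat p ^ m * u" using cong_powE[OF prime h] .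
  then show ?thesis
    by (intro cong_powI[OF prime, of u]) (auto simp: algebra_simps power_add)
qed

lemma cong_pow_sum:
  "(\<And>i. i \<in> A \<Longrightarrow> cong_pow p m (f i) (g i)) \<Longrightarrow> cong_pow p m (sum f A) (sum g A)"
  by (induction A rule: infinite_finite_induct) (auto intro: cong_pow_add)

lemma cong_pow_prod:
  "(\<And>i. i \<in> A \<Longrightarrow> cong_pow p m (f i) (g i)) \<Longrightarrow> (\<And>i. i \<in> A \<Longrightarrow> g i \<in> Zp p) \<Longrightarrow>
   cong_pow p m (prod f A) (prod g A)"
  by (induction A rule: infinite_finite_induct) (auto intro!: cong_pow_mult Zp_prod)

lemma cong_pow_power: "cong_pow p m (x ^ n) (y ^ n)" if "cong_pow p m x y" "y \<in> Zp p"
  using cong_pow_prod[of "{..<n}" m "\<lambda>_. x" "\<lambda>_. y"] that by simp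

section \<open>Approximation by natural numbers and Fermat's theorem\<close>

lemma residue_props:
  assumes "a \<in> Zp p"
  shows "residue p a < p" "cong_pow p 1 a (of_nat (residue p a))"
  using theI'[OF ex1_residue[OF prime assms]] unfolding residue_def by auto

text \<open>The \<open>p\<close>-adic digits of \<open>a\<close> are split off one by one with
  \<open>residue\<close>; \<open>n\<close> is assembled from the first \<open>m\<close> of
  them.\<close>

lemma ex_nat_cong_pow:
  assumes "a \<in> Zp p"
  shows "\<exists>n. cong_pow p m a (of_nat n)"
  using assms
proof (induction m arbitrary: a)
  case 0
  then show ?case by (intro exI[of _ 0]) (auto simp: cong_pow_def)
next
  case (Suc m)
  define r where "r = residue p a"
  obtain b where b: "b \<in> Zp p" "a = of_nat r + of_nat p ^ 1 * b"
    using cong_powE[OF prime residue_props(2)[OF Suc.prems]] unfolding r_def .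
  obtain n where n: "cong_pow p m b (of_nat n)" using Suc.IH[OF b(1)] by blast
  have "cong_pow p (1 + m) a (of_nat r + of_nat p ^ 1 * of_nat n)"
    unfolding b(2) by (intro cong_pow_add cong_pow_scale n cong_pow_refl)
  then show ?case by (intro exI[of _ "r + p * n"]) simp
qed

lemma fermat_Zp:
  assumes x: "x \<in> Zp p" and x0: "\<not> cong_pow p 1 x 0"
  shows "cong_pow p 1 (x ^ (p - 1)) 1"
proof -
  define r where "r = residue p x"
  have r: "cong_pow p 1 x (of_nat r)" unfolding r_def by (rule residue_props(2)[OF x])
  have "\<not> p dvd r"
    using x0 cong_pow_trans[OF r] cong_pow_of_nat_0_iff by blast
  then have "[r ^ (p - 1) = 1] (mod p)" by (rule fermat_theorem[OF prime])
  then have "[int (r ^ (p - 1)) = int 1] (mod int p)" by (simp only: cong_int_iff)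
  then obtain k where "int (r ^ (p - 1)) - int 1 = int p * k"
    by (auto simp: cong_iff_dvd_diff elim: dvdE)
  then have "rat_of_int (int (r ^ (p - 1)) - int 1) = of_int (int p * k)" by (rule arg_cong)
  then have "cong_pow p 1 (of_nat r ^ (p - 1)) 1"
    by (intro cong_powI[OF prime, of "of_int k"]) auto
  with cong_pow_power[OF r Zp_of_nat, of "p - 1"] show ?thesis by (rule cong_pow_trans)
qed

text \<open>By Fermat, \<open>x ^ (p - 3)\<close> is the inverse square of \<open>x\<close> modulo
  \<open>p\<close>, and \<open>- (p - 2)\<close> is \<open>2\<close>. The left side is shaped like
  the terms in \<open>bernpoly_minus_nat\<close> for \<open>n = p - 2\<close>.\<close>

lemma cong_inverse_square:
  assumes x: "x \<in> Zp p" and x0: "\<not> cong_pow p 1 x 0" and p: "p > 3"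
  shows "cong_pow p 1 (- of_nat (p - 2) * x ^ (p - 3)) (2 / x\<^sup>2)"
proof -
  obtain z where z: "z \<in> Zp p" "x ^ (p - 1) = 1 + of_nat p ^ 1 * z"
    using cong_powE[OF prime fermat_Zp[OF x x0]] .
  define y where "y = 1 / x"
  have y: "y \<in> Zp p" unfolding y_def by (rule Zp_inverse[OF x x0])
  have "x \<noteq> 0" using x0 by auto
  then have xy: "x * y = 1" by (simp add: y_def)
  have "p - 1 = (p - 3) + 2" using p by simp
  then have "x ^ (p - 1) * y\<^sup>2 = x ^ (p - 3) * (x * y)\<^sup>2"
    by (simp only: power_add power_mult_distrib mult.assoc)
  then have e: "x ^ (p - 3) = (1 + of_nat p * z) * y\<^sup>2"
    using xy z by simp
  have "of_nat (p - 2) = (of_nat p - 2 :: rat)" using p by (simp add: of_nat_diff)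
  moreover have "2 / x\<^sup>2 = 2 * y\<^sup>2" by (simp add: y_def power_divide)
  \<comment> \<open>The witness comes from
    \<open>(2 - p) * (1 + p * z) - 2 = p * (2 * z - (1 + p * z))\<close>.\<close>
  ultimately show ?thesis unfolding e
    using y z by (intro cong_powI[OF prime, of "(2 * z - (1 + of_nat p * z)) * y\<^sup>2"])
      (auto simp: algebra_simps)
qed

text \<open>The recurrence for index \<open>k\<close> divides by \<open>Suc k < p\<close>, a unit;
  at \<open>k = p - 1\<close> the divisor would be \<open>p\<close> itself. Index
  \<open>p - 2\<close> of the Bernoulli polynomial stays just within this range.\<close>

lemma bernoulli_Zp: "k < p - 1 \<Longrightarrow> bernoulli k \<in> Zp p"
proof (induction k rule: less_induct)
  case (less k)
  show ?case
  proof (cases "k = 0")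
    case False
    have "(\<Sum>i<k. of_nat (Suc k choose i) * bernoulli i) \<in> Zp p"
      using less by (intro Zp_sum Zp_mult) auto
    with False less.prems show ?thesis
      by (subst bernoulli.simps) (auto intro!: Zp_divide_nat_less simp del: of_nat_Suc)
  qed (simp add: bernoulli_0)
qed

lemma bernpoly_cong:
  assumes "cong_pow p m x y" "y \<in> Zp p"
  shows "cong_pow p m (bernpoly (p - 2) x) (bernpoly (p - 2) y)"
  unfolding bernpoly_def using prime_gt_1_nat[OF prime] assms
  by (intro cong_pow_sum cong_pow_cmult cong_pow_power Zp_mult bernoulli_Zp) auto

lemma bernpoly_minus_nat_cong:
  assumes p: "p > 3" and r: "r < p"
  shows "cong_pow p 1 (bernpoly (p - 2) (- of_nat r)) (2 * (\<Sum>i=1..r. 1 / (of_nat i)\<^sup>2))"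
proof -
  have "odd p" using p prime prime_odd_nat by auto
  then have "bernpoly (p - 2) (- of_nat r) = - of_nat (p - 2) * (\<Sum>i=1..r. of_nat i ^ (p - 2 - 1))"
    using p by (intro bernpoly_minus_nat) auto
  also have "\<dots> = (\<Sum>i=1..r. - of_nat (p - 2) * of_nat i ^ (p - 3))"
    by (simp only: sum_distrib_left diff_diff_left) simp
  also have "cong_pow p 1 \<dots> (\<Sum>i=1..r. 2 / (of_nat i)\<^sup>2)"
    using p r by (intro cong_pow_sum cong_inverse_square) (auto simp: cong_pow_of_nat_0_iff nat_dvd_not_less simp del: One_nat_def)
  finally show ?thesis by (simp add: sum_distrib_left)
qed

text \<open>Twice the sum is \<open>B(- (p - 1))\<close> modulo \<open>p\<close>, where
  \<open>B\<close> has index \<open>p - 2\<close>. As \<open>- (p - 1)\<close> is \<open>1\<close>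
  modulo \<open>p\<close>, this is \<open>B(1) = B(0) = 0\<close>; finally \<open>2\<close> is a
  unit.\<close>

lemma sum_inverse_squares_cong_0:
  assumes p: "p > 3"
  shows "cong_pow p 1 (\<Sum>i=1..p - 1. 1 / (of_nat i)\<^sup>2) 0"
proof -
  have "odd p" using p prime prime_odd_nat by auto
  then have b1: "bernpoly (p - 2) 1 = 0"
    using bernpoly_diff[of "p - 2" 0] bernpoly_odd_0[of "p - 2"] p by (simp add: power_0_left)
  have "- of_nat (p - 1) - 1 = of_nat p ^ 1 * (- 1 :: rat)" using p by (simp add: of_nat_diff)
  then have "cong_pow p 1 (- of_nat (p - 1)) 1"
    by (intro cong_powI[OF prime, of "- 1"]) auto
  then have "cong_pow p 1 (bernpoly (p - 2) (- of_nat (p - 1))) (bernpoly (p - 2) 1)"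
    by (rule bernpoly_cong) auto
  moreover have "cong_pow p 1 (bernpoly (p - 2) (- of_nat (p - 1))) (2 * (\<Sum>i=1..p - 1. 1 / (of_nat i)\<^sup>2))"
    using p by (intro bernpoly_minus_nat_cong) auto
  ultimately have "cong_pow p 1 (2 * (\<Sum>i=1..p - 1. 1 / (of_nat i)\<^sup>2)) 0"
    using b1 cong_pow_trans cong_pow_sym by metis
  moreover have "1 / of_nat 2 \<in> Zp p" using p by (intro Zp_inverse_nat_less) auto
  ultimately have "cong_pow p 1 (1 / of_nat 2 * (2 * (\<Sum>i=1..p - 1. 1 / (of_nat i)\<^sup>2))) (1 / of_nat 2 * 0)"
    by (rule cong_pow_cmult)
  then show ?thesis by simp
qed

section \<open>The sum modulo the cube of a prime\<close>

text \<open>The factor at \<open>i = j\<close> equals \<open>- p * s / j\<close>, and the product of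
  the others is \<open>-1\<close> modulo \<open>p\<close>. The cofactor \<open>A\<close> is exposed
  so that two such products give \<open>p ^ 2\<close> times something known modulo
  \<open>p\<close>.\<close>

lemma prod_one_minus_div_cong:
  assumes s: "s \<in> Zp p" and j: "1 \<le> j" "j < p"
  shows "\<exists>A. (\<Prod>i=1..p - 1. 1 - (of_nat p * s + of_nat j) / of_nat i) = of_nat p * A
    \<and> cong_pow p 1 A (s / of_nat j)"
proof -
  define R where "R x = (\<Prod>i\<in>{1..p - 1} - {j}. 1 - x / of_nat i)" for x :: rat
  \<comment> \<open>The form \<open>p - 1 + 1\<close> matches
    \<open>prod_one_minus_div_delete\<close> at \<open>M = p - 1\<close>. Every factor is
    \<open>1 - p / i\<close>, so \<open>W\<close> is \<open>1\<close> modulo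
    \<open>p\<close>.\<close>
  define W :: rat where "W = (\<Prod>i=1..j. 1 - of_nat (p - 1 + 1) / of_nat i)"
  have R_Zp: "R x \<in> Zp p" if "x \<in> Zp p" for x
    unfolding R_def using that by (intro Zp_prod Zp_diff Zp_divide_nat_less) auto
  have RW: "R (of_nat j) * W = - 1"
    unfolding R_def W_def using j by (intro prod_one_minus_div_delete) auto
  have "cong_pow p 1 W (\<Prod>i=1..j. 1)"
    unfolding W_def
  proof (intro cong_pow_prod)
    fix i assume i: "i \<in> {1..j}"
    then show "cong_pow p 1 (1 - of_nat (p - 1 + 1) / of_nat i) 1"
      using j by (intro cong_powI[OF prime, of "- (1 / of_nat i)"] Zp_uminus Zp_inverse_nat_less) auto
  qed auto
  then have "cong_pow p 1 (R (of_nat j) * W) (R (of_nat j) * 1)"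
    by (intro cong_pow_cmult R_Zp) auto
  then have R1: "cong_pow p 1 (R (of_nat j)) (- 1)"
    by (simp add: RW cong_pow_sym)
  have "cong_pow p 1 (R (of_nat p * s + of_nat j)) (R (of_nat j))"
    unfolding R_def
  proof (intro cong_pow_prod)
    fix i assume i: "i \<in> {1..p - 1} - {j}"
    show "cong_pow p 1 (1 - (of_nat p * s + of_nat j) / of_nat i) (1 - of_nat j / of_nat i)"
      using i s by (intro cong_powI[OF prime, of "- (s / of_nat i)"] Zp_uminus Zp_divide_nat_less)
        (auto simp: field_simps)
    show "1 - of_nat j / of_nat i \<in> Zp p"
      using i by (intro Zp_diff Zp_divide_nat_less) auto
  qed
  then have "cong_pow p 1 (R (of_nat p * s + of_nat j)) (- 1)"
    using R1 cong_pow_trans by blast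
  then have "cong_pow p 1 (- (s / of_nat j) * R (of_nat p * s + of_nat j)) (- (s / of_nat j) * - 1)"
    using s j by (intro cong_pow_cmult Zp_uminus Zp_divide_nat_less) auto
  moreover have "(\<Prod>i=1..p - 1. 1 - (of_nat p * s + of_nat j) / of_nat i)
      = (1 - (of_nat p * s + of_nat j) / of_nat j) * R (of_nat p * s + of_nat j)"
    unfolding R_def using j by (intro prod.remove) auto
  moreover have "1 - (of_nat p * s + of_nat j) / of_nat j = of_nat p * - (s / of_nat j)"
    using j by (simp add: field_simps)
  ultimately show ?thesis
    by (intro exI[of _ "- (s / of_nat j) * R (of_nat p * s + of_nat j)"]) simp
qed

text \<open>Each factor splits as \<open>(1 - x / i) * (1 + x / i)\<close>, and the previous lemma
  applies to both \<open>x\<close> and \<open>- x\<close>, each half contributing one factor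
  \<open>p\<close>.\<close>

lemma prod_one_minus_square_cong:
  assumes s: "s \<in> Zp p" and j: "1 \<le> j" "j < p"
  shows "cong_pow p 3 (\<Prod>i=1..p - 1. 1 - ((of_nat p * s + of_nat j) / of_nat i)\<^sup>2)
    (of_nat p ^ 2 * (s * (s + 1) * (1 / (of_nat j)\<^sup>2)))"
proof -
  define x where "x = of_nat p * s + of_nat j"
  \<comment> \<open>Negation changes \<open>s\<close> into \<open>- (s + 1)\<close> and
    \<open>j\<close> into \<open>p - j\<close>; hence the product \<open>s * (s + 1)\<close> in the
    result.\<close>
  have x': "- x = of_nat p * (- (s + 1)) + of_nat (p - j)"
    using j by (simp add: x_def of_nat_diff algebra_simps)
  obtain A where A: "(\<Prod>i=1..p - 1. 1 - x / of_nat i) = of_nat p * A" "cong_pow p 1 A (s / of_nat j)"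
    using prod_one_minus_div_cong[OF s j] unfolding x_def by blast
  obtain B where B: "(\<Prod>i=1..p - 1. 1 - (- x) / of_nat i) = of_nat p * B"
      "cong_pow p 1 B (- (s + 1) / of_nat (p - j))"
  proof -
    have "1 \<le> p - j" "p - j < p" using j by auto
    with s show thesis
      using that prod_one_minus_div_cong[of "- (s + 1)" "p - j"] unfolding x' by blast
  qed
  have "cong_pow p 1 (- (s + 1) / of_nat (p - j)) ((s + 1) / of_nat j)"
  proof (rule cong_powI[OF prime])
    show "- ((s + 1) / of_nat j / of_nat (p - j)) \<in> Zp p"
      using s j by (intro Zp_uminus Zp_divide_nat_less) auto
    have "of_nat (p - j) = (of_nat p - of_nat j :: rat)" "of_nat j \<noteq> (0 :: rat)" "of_nat p - of_nat j \<noteq> (0 :: rat)"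
      using j by (auto simp: of_nat_diff)
    then show "- (s + 1) / of_nat (p - j) - (s + 1) / of_nat j
        = of_nat p ^ 1 * - ((s + 1) / of_nat j / of_nat (p - j))"
      by (simp add: divide_simps) (simp add: algebra_simps)
  qed
  then have B': "cong_pow p 1 B ((s + 1) / of_nat j)" using B(2) cong_pow_trans by blast
  have "cong_pow p 1 (A * B) (s / of_nat j * ((s + 1) / of_nat j))"
    using A(2) B' s j by (intro cong_pow_mult Zp_divide_nat_less) auto
  then have "cong_pow p (2 + 1) (of_nat p ^ 2 * (A * B)) (of_nat p ^ 2 * (s / of_nat j * ((s + 1) / of_nat j)))"
    by (rule cong_pow_scale)
  moreover have "(\<Prod>i=1..p - 1. 1 - (x / of_nat i)\<^sup>2)
      = (\<Prod>i=1..p - 1. (1 - x / of_nat i) * (1 - (- x) / of_nat i))"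
    by (intro prod.cong) (auto simp: power2_eq_square algebra_simps)
  then have "(\<Prod>i=1..p - 1. 1 - (x / of_nat i)\<^sup>2) = of_nat p ^ 2 * (A * B)"
    unfolding prod.distrib A(1) B(1) by (simp add: power2_eq_square)
  ultimately show ?thesis unfolding x_def by (simp add: power2_eq_square)
qed

text \<open>First-order expansion with an integral remainder. It is used with
  \<open>c = - (p * s) ^ 2\<close>, for which \<open>c ^ 2\<close> is divisible by
  \<open>p ^ 4\<close>.\<close>

lemma prod_one_plus_expand:
  assumes "c \<in> Zp p" "\<And>i. i \<in> A \<Longrightarrow> y i \<in> Zp p"
  shows "\<exists>z\<in>Zp p. (\<Prod>i\<in>A. 1 + c * y i) = 1 + c * (\<Sum>i\<in>A. y i) + c\<^sup>2 * z"
  using assms(2)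
proof (induction A rule: infinite_finite_induct)
  case (insert i A)
  then obtain z where z: "z \<in> Zp p" "(\<Prod>i\<in>A. 1 + c * y i) = 1 + c * (\<Sum>i\<in>A. y i) + c\<^sup>2 * z"
    by auto
  have "(\<Sum>i\<in>A. y i) \<in> Zp p" using insert by (intro Zp_sum) auto
  then show ?case using insert z assms(1)
    by (intro bexI[of _ "y i * (\<Sum>i\<in>A. y i) + z + c * y i * z"])
      (auto simp: algebra_simps power2_eq_square)
qed (auto intro: bexI[of _ 0])

text \<open>The linear term is \<open>p ^ 2\<close> times a multiple of the sum of inverse squares,
  which supplies the third factor \<open>p\<close>.\<close>

lemma prod_one_minus_square_multiple_cong:
  assumes s: "s \<in> Zp p" and p: "p > 3"
  shows "cong_pow p 3 (\<Prod>i=1..p - 1. 1 - (of_nat p * s / of_nat i)\<^sup>2) 1"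
proof -
  define y :: "nat \<Rightarrow> rat" where "y i = 1 / (of_nat i)\<^sup>2" for i
  have "y i \<in> Zp p" if h: "i \<in> {1..p - 1}" for i
  proof -
    have "(1 / of_nat i) ^ 2 \<in> Zp p" using h by (intro Zp_power Zp_inverse_nat_less) auto
    then show ?thesis by (simp add: y_def power_divide)
  qed
  then obtain z where z: "z \<in> Zp p"
    "(\<Prod>i=1..p - 1. 1 + - (of_nat p * s)\<^sup>2 * y i)
      = 1 + - (of_nat p * s)\<^sup>2 * (\<Sum>i=1..p - 1. y i) + (- (of_nat p * s)\<^sup>2)\<^sup>2 * z"
    using prod_one_plus_expand[of "- (of_nat p * s)\<^sup>2" "{1..p - 1}" y] s by blast
  obtain w where w: "w \<in> Zp p" "(\<Sum>i=1..p - 1. y i) = 0 + of_nat p ^ 1 * w"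
    using cong_powE[OF prime sum_inverse_squares_cong_0[OF p]] unfolding y_def .
  show ?thesis
  proof (rule cong_powI[OF prime])
    show "- s\<^sup>2 * w + of_nat p * s ^ 4 * z \<in> Zp p" using s z w by auto
    show "(\<Prod>i=1..p - 1. 1 - (of_nat p * s / of_nat i)\<^sup>2) - 1
        = of_nat p ^ 3 * (- s\<^sup>2 * w + of_nat p * s ^ 4 * z)"
    proof -
      have "(\<Prod>i=1..p - 1. 1 - (of_nat p * s / of_nat i)\<^sup>2) = (\<Prod>i=1..p - 1. 1 + - (of_nat p * s)\<^sup>2 * y i)"
        by (intro prod.cong) (auto simp: y_def power_divide)
      also have "\<dots> = 1 + of_nat p ^ 3 * (- s\<^sup>2 * w + of_nat p * s ^ 4 * z)"
        unfolding z(2) w(2) by (simp add: algebra_simps power2_eq_square power3_eq_cube power4_eq_xxxx)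
      finally show ?thesis by simp
    qed
  qed
qed

text \<open>Unit steps by \<open>scaled_sum_diff\<close>; since \<open>r < p\<close>, no step
  reaches the next multiple of \<open>p\<close>, so \<open>prod_one_minus_square_cong\<close> covers
  all of them.\<close>

lemma scaled_sum_block:
  assumes s: "s \<in> Zp p" and r: "r < p"
  shows "cong_pow p 3 (scaled_sum p (of_nat p * s + of_nat r))
    (scaled_sum p (of_nat p * s) + 2 * (of_nat p ^ 2 * (s * (s + 1) * (\<Sum>i=1..r. 1 / (of_nat i)\<^sup>2))))"
  using r
proof (induction r)
  case (Suc r)
  let ?P = "\<Prod>i=1..p - 1. 1 - ((of_nat p * s + of_nat (Suc r)) / of_nat i)\<^sup>2"
  have "scaled_sum p (of_nat p * s + of_nat (Suc r)) = scaled_sum p (of_nat p * s + of_nat r) + 2 * ?P"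
    using scaled_sum_diff[of p "of_nat p * s + of_nat (Suc r)"] by (simp add: algebra_simps)
  also have "cong_pow p 3 \<dots>
    ((scaled_sum p (of_nat p * s) + 2 * (of_nat p ^ 2 * (s * (s + 1) * (\<Sum>i=1..r. 1 / (of_nat i)\<^sup>2))))
     + 2 * (of_nat p ^ 2 * (s * (s + 1) * (1 / (of_nat (Suc r))\<^sup>2))))"
    using s Suc by (intro cong_pow_add cong_pow_cmult prod_one_minus_square_cong Suc.IH) auto
  also have "\<dots> = scaled_sum p (of_nat p * s)
      + 2 * (of_nat p ^ 2 * (s * (s + 1) * (\<Sum>i=1..Suc r. 1 / (of_nat i)\<^sup>2)))"
    by (simp add: algebra_simps del: of_nat_Suc)
  finally show ?case .
qed simp

lemma scaled_sum_multiple_step: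
  assumes s: "s \<in> Zp p" and p: "p > 3"
  shows "cong_pow p 3 (scaled_sum p (of_nat p * (s + 1))) (scaled_sum p (of_nat p * s) + 2)"
proof -
  let ?P = "\<Prod>i=1..p - 1. 1 - (of_nat p * (s + 1) / of_nat i)\<^sup>2"
  let ?H = "\<Sum>i=1..p - 1. 1 / (of_nat i)\<^sup>2 :: rat"
  have "cong_pow p 1 (2 * (s * (s + 1)) * ?H) (2 * (s * (s + 1)) * 0)"
    using s by (intro cong_pow_cmult sum_inverse_squares_cong_0 p) auto
  then have "cong_pow p (2 + 1) (of_nat p ^ 2 * (2 * (s * (s + 1)) * ?H)) (of_nat p ^ 2 * (2 * (s * (s + 1)) * 0))"
    by (rule cong_pow_scale)
  then have "cong_pow p 3 (of_nat p ^ 2 * (2 * (s * (s + 1)) * ?H)) 0" by simp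
  moreover have "of_nat p ^ 2 * (2 * (s * (s + 1)) * ?H) = 2 * (of_nat p ^ 2 * (s * (s + 1) * ?H))"
    by (simp only: mult_ac)
  ultimately have H: "cong_pow p 3 (2 * (of_nat p ^ 2 * (s * (s + 1) * ?H))) 0" by (simp only:)
  \<comment> \<open>A full block of \<open>p - 1\<close> steps contributes \<open>0\<close> by
    \<open>H\<close>; the remaining step, onto the multiple of \<open>p\<close>, contributes
    \<open>2\<close>.\<close>
  have e: "of_nat p * (s + 1) - 1 = of_nat p * s + of_nat (p - 1)"
    using p by (simp add: of_nat_diff algebra_simps)
  have "scaled_sum p (of_nat p * (s + 1)) = scaled_sum p (of_nat p * s + of_nat (p - 1)) + 2 * ?P"
    using scaled_sum_diff[of p "of_nat p * (s + 1)"] unfolding e by simp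
  also have "cong_pow p 3 \<dots> (scaled_sum p (of_nat p * s) + 2 * (of_nat p ^ 2 * (s * (s + 1) * ?H)) + 2 * 1)"
    using s p by (intro cong_pow_add cong_pow_cmult prod_one_minus_square_multiple_cong scaled_sum_block) auto
  also have "cong_pow p 3 \<dots> (scaled_sum p (of_nat p * s) + 0 + 2 * 1)"
    by (intro cong_pow_add H cong_pow_refl)
  finally show ?thesis by simp
qed

section \<open>Values at multiples of \<open>p\<close>, by induction and continuity\<close>

lemma scaled_sum_0: "scaled_sum p 0 = 1"
proof -
  have "(\<Sum>k=0..p - 1. (0 gchoose k) * (- 1 - 0 gchoose k) * (1 / of_nat (2 * k + 1)))
    = (\<Sum>k\<in>{0}. (0 gchoose k) * (- 1 - 0 gchoose k) * (1 / of_nat (2 * k + 1)) :: rat)"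
    by (intro sum.mono_neutral_right) (auto simp: gbinomial_0_left)
  then show ?thesis by (simp add: scaled_sum_def)
qed

lemma scaled_sum_multiple_nat:
  assumes p: "p > 3"
  shows "cong_pow p 3 (scaled_sum p (of_nat p * of_nat n)) (1 + 2 * of_nat n)"
proof (induction n)
  case (Suc n)
  have "cong_pow p 3 (scaled_sum p (of_nat p * (of_nat n + 1))) (scaled_sum p (of_nat p * of_nat n) + 2)"
    by (intro scaled_sum_multiple_step p Zp_of_nat)
  also have "cong_pow p 3 \<dots> (1 + 2 * of_nat n + 2)"
    by (intro cong_pow_add Suc.IH cong_pow_refl)
  finally show ?case by (simp add: algebra_simps)
qed (simp add: scaled_sum_0)

text \<open>For \<open>k < p\<close> the only denominator, \<open>fact k\<close>, is a unit, so the
  binomial coefficient is a polynomial over \<open>Zp p\<close>.\<close>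

lemma gbinomial_Zp_cong:
  assumes "cong_pow p m x y" "y \<in> Zp p" "k < p"
  shows "y gchoose k \<in> Zp p" "cong_pow p m (x gchoose k) (y gchoose k)"
proof -
  have f: "1 / fact k \<in> Zp p"
    using Zp_inverse_nat[of "fact k"] prime_dvd_fact_iff[OF prime, of k] assms(3) by simp
  have e: "(x gchoose k) = 1 / fact k * (\<Prod>i=0..<k. x - of_nat i)" for x :: rat
    by (simp add: gbinomial_prod_rev)
  show "y gchoose k \<in> Zp p"
    unfolding e using assms by (intro Zp_mult f Zp_prod Zp_diff) auto
  show "cong_pow p m (x gchoose k) (y gchoose k)"
    unfolding e using assms by (intro cong_pow_cmult f cong_pow_prod cong_pow_diff cong_pow_refl) auto
qed

text \<open>One power of \<open>p\<close> is lost because \<open>2 * k + 1 = p\<close> for \<open>k = (p - 1) div 2\<close>.\<close>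
lemma scaled_sum_cong:
  assumes xy: "cong_pow p (m + 1) x y" and y: "y \<in> Zp p"
  shows "cong_pow p m (scaled_sum p x) (scaled_sum p y)"
proof -
  have p0: "p > 0" using prime prime_gt_0_nat by blast
  \<comment> \<open>The extra factor \<open>p\<close> makes all coefficients integral, so
    \<open>T\<close> respects congruences; dividing by \<open>p\<close> at the end costs one
    power.\<close>
  define T where "T x = (\<Sum>k=0..p - 1. (x gchoose k) * ((- 1 - x) gchoose k) * (of_nat p / of_nat (2 * k + 1)))"
    for x :: rat
  have c: "of_nat p / of_nat (2 * k + 1) \<in> Zp p" if "k < p" for k
  proof (cases "p dvd 2 * k + 1")
    case True
    then obtain q where q: "2 * k + 1 = p * q" by (elim dvdE)
    \<comment> \<open>As \<open>2 * k + 1 < 2 * p\<close>, the only multiple of \<open>p\<close>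
      that can occur is \<open>p\<close> itself, with quotient \<open>1\<close>.\<close>
    have "p * q < p * 2" unfolding q[symmetric] using that by simp
    moreover have "q \<noteq> 0" using q by (cases q) auto
    ultimately have "q = 1" using p0 by simp
    then have "2 * k + 1 = p" using q by simp
    then show ?thesis using p0 by simp
  next
    case False
    then show ?thesis using Zp_mult[OF Zp_of_nat Zp_inverse_nat[OF False], of p] by simp
  qed
  have T: "scaled_sum p x = (2 * x + 1) * T x / of_nat p" for x
    using p0 by (simp add: scaled_sum_def T_def sum_distrib_left sum_divide_distrib)
  have g: "(y gchoose k) * ((- 1 - y) gchoose k) \<in> Zp p" if "k < p" for k
    using that y by (intro Zp_mult gbinomial_Zp_cong(1)[OF cong_pow_refl]) auto
  have "cong_pow p (m + 1) (T x) (T y)"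
    unfolding T_def
  proof (intro cong_pow_sum cong_pow_mult cong_pow_refl gbinomial_Zp_cong(2) xy y g c cong_pow_diff)
    fix k assume "k \<in> {0..p - 1}"
    then show k: "k < p" using p0 by simp
    then show "k < p" "k < p" "k < p" by simp_all
    show "y gchoose k \<in> Zp p" "- 1 - y gchoose k \<in> Zp p"
      using k y by (auto intro!: gbinomial_Zp_cong(1)[OF cong_pow_refl])
  qed (use y in auto)
  moreover have "T y \<in> Zp p"
    unfolding T_def using p0 by (intro Zp_sum Zp_mult[OF g c]) auto
  ultimately have "cong_pow p (m + 1) ((2 * x + 1) * T x) ((2 * y + 1) * T y)"
    using xy y by (intro cong_pow_mult cong_pow_add cong_pow_cmult cong_pow_refl) auto
  then have "((2 * x + 1) * T x - (2 * y + 1) * T y) / of_nat p ^ (m + 1) \<in> Zp p"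
    by (simp only: cong_pow_def)
  moreover have "((2 * x + 1) * T x - (2 * y + 1) * T y) / of_nat p ^ (m + 1)
      = (scaled_sum p x - scaled_sum p y) / of_nat p ^ m"
    unfolding T using p0 by (simp add: field_simps)
  ultimately show ?thesis by (simp only: cong_pow_def)
qed

text \<open>Approximating \<open>s\<close> modulo \<open>p ^ 3\<close> gives \<open>p * s\<close>
  modulo \<open>p ^ 4\<close>, exactly enough to absorb the power lost in
  \<open>scaled_sum_cong\<close>.\<close>

lemma scaled_sum_multiple:
  assumes s: "s \<in> Zp p" and p: "p > 3"
  shows "cong_pow p 3 (scaled_sum p (of_nat p * s)) (1 + 2 * s)"
proof -
  obtain n where n: "cong_pow p 3 s (of_nat n)" using ex_nat_cong_pow[OF s] by blast
  have "cong_pow p (3 + 1) (of_nat p * s) (of_nat p * of_nat n)"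
    using cong_pow_scale[OF n, of 1] by simp
  then have "cong_pow p 3 (scaled_sum p (of_nat p * s)) (scaled_sum p (of_nat p * of_nat n))"
    by (intro scaled_sum_cong) auto
  also have "cong_pow p 3 \<dots> (1 + 2 * of_nat n)"
    by (rule scaled_sum_multiple_nat[OF p])
  also have "cong_pow p 3 \<dots> (1 + 2 * s)"
    by (intro cong_pow_add cong_pow_cmult cong_pow_sym[OF n] cong_pow_refl) auto
  finally show ?thesis .
qed

end

theorem theorem3p1:
  fixes p :: nat and a t :: rat
  assumes "prime p" and "p > 3"
    and "a \<in> Zp p"
    and "\<not> cong_pow p 1 (a * (2 * a + 1)) 0"
    and "t = (a - of_nat (residue p a)) / of_nat p"
  shows "cong_pow p 3
           (\<Sum>k=0..p - 1. (a gchoose k) * ((- 1 - a) gchoose k) * (1 / of_nat (2 * k + 1)))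
           ((1 + 2 * t) / (1 + 2 * a)
              + of_nat p ^ 2 * (t * (t + 1) / (1 + 2 * a)) * bernpoly (p - 2) (- a))
       \<and> cong_pow p 3
           ((1 + 2 * t) / (1 + 2 * a)
              + of_nat p ^ 2 * (t * (t + 1) / (1 + 2 * a)) * bernpoly (p - 2) (- a))
           ((1 + 2 * t) / (1 + 2 * a)
              + of_nat p ^ 2 * (t * (t + 1) / (1 + 2 * a)) * (2 / a ^ 2 - bernpoly (p - 2) a))"
proof -
  note prime = \<open>prime p\<close> and p = \<open>p > 3\<close> and a = \<open>a \<in> Zp p\<close>
  note Zp_simps = Zp_numeral[OF prime] Zp_add[OF prime] Zp_mult[OF prime] Zp_uminus[OF prime] Zp_of_nat[OF prime]
  define r where "r = residue p a"
  define S where "S = (\<Sum>k=0..p - 1. (a gchoose k) * ((- 1 - a) gchoose k) * (1 / of_nat (2 * k + 1)))"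
  define B where "B = bernpoly (p - 2) (- a)"
  have p0: "of_nat p \<noteq> (0 :: rat)" using p by simp
  have r: "r < p" "cong_pow p 1 a (of_nat r)"
    using residue_props[OF prime a] by (simp_all add: r_def)
  have t: "t \<in> Zp p" using r(2) assms(5) by (simp add: cong_pow_def r_def)
  have at: "a = of_nat p * t + of_nat r" using p0 assms(5) by (simp add: r_def)
  \<comment> \<open>The hypothesis on \<open>a * (2 * a + 1)\<close> is split: \<open>a\<close> must
    be a unit for \<open>2 / a ^ 2\<close>, and \<open>1 + 2 * a\<close> for undoing the
    scaling.\<close>
  have a0: "\<not> cong_pow p 1 a 0"
  proof
    assume "cong_pow p 1 a 0"
    from cong_pow_cmult[OF prime this, of "2 * a + 1"] show False
      using a assms(4) by (simp add: mult.commute Zp_simps)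
  qed
  have "\<not> cong_pow p 1 (1 + 2 * a) 0"
  proof
    assume "cong_pow p 1 (1 + 2 * a) 0"
    from cong_pow_cmult[OF prime this a] show False
      using assms(4) by (simp add: add.commute)
  qed
  then have u: "1 / (1 + 2 * a) \<in> Zp p"
    using a by (intro Zp_inverse[OF prime]) (auto simp: Zp_simps)
  have u0: "1 + 2 * a \<noteq> 0"
    using \<open>\<not> cong_pow p 1 (1 + 2 * a) 0\<close> cong_pow_refl[OF prime] by metis
  have c: "t * (t + 1) / (1 + 2 * a) \<in> Zp p"
    using Zp_mult[OF prime _ u, of "t * (t + 1)"] t by (simp add: Zp_simps)

  \<comment> \<open>The sum over \<open>i \<le> r\<close> is needed only modulo \<open>p\<close>,
    where \<open>- r\<close> may be replaced by \<open>- a\<close>.\<close>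
  have "cong_pow p 1 (- a) (- of_nat r)" by (rule cong_pow_uminus[OF prime r(2)])
  then have "cong_pow p 1 B (bernpoly (p - 2) (- of_nat r))"
    unfolding B_def by (rule bernpoly_cong[OF prime]) (simp add: Zp_simps)
  moreover have "cong_pow p 1 (bernpoly (p - 2) (- of_nat r)) (2 * (\<Sum>i=1..r. 1 / (of_nat i)\<^sup>2))"
    by (rule bernpoly_minus_nat_cong[OF prime p r(1)])
  ultimately have "cong_pow p 1 (2 * (\<Sum>i=1..r. 1 / (of_nat i)\<^sup>2)) B"
    using cong_pow_trans[OF prime] cong_pow_sym[OF prime] by blast
  then have "cong_pow p (2 + 1) (of_nat p ^ 2 * (t * (t + 1) * (2 * (\<Sum>i=1..r. 1 / (of_nat i)\<^sup>2))))
      (of_nat p ^ 2 * (t * (t + 1) * B))"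
    using t by (intro cong_pow_scale cong_pow_cmult prime) (simp_all add: Zp_simps)
  then have "cong_pow p 3 (2 * (of_nat p ^ 2 * (t * (t + 1) * (\<Sum>i=1..r. 1 / (of_nat i)\<^sup>2))))
      (of_nat p ^ 2 * (t * (t + 1) * B))"
    by (simp add: mult_ac)
  with scaled_sum_multiple[OF prime t p]
  have "cong_pow p 3 (scaled_sum p (of_nat p * t) + 2 * (of_nat p ^ 2 * (t * (t + 1) * (\<Sum>i=1..r. 1 / (of_nat i)\<^sup>2))))
      (1 + 2 * t + of_nat p ^ 2 * (t * (t + 1) * B))"
    by (rule cong_pow_add[OF prime])
  with scaled_sum_block[OF prime t r(1)]
  have "cong_pow p 3 (scaled_sum p a) (1 + 2 * t + of_nat p ^ 2 * (t * (t + 1) * B))"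
    unfolding at[symmetric] by (rule cong_pow_trans[OF prime])
  from cong_pow_cmult[OF prime this u]
  have "cong_pow p 3 (1 / (1 + 2 * a) * scaled_sum p a)
      (1 / (1 + 2 * a) * (1 + 2 * t + of_nat p ^ 2 * (t * (t + 1) * B)))" .
  moreover have "1 / (1 + 2 * a) * scaled_sum p a = S"
    using u0 unfolding scaled_sum_def S_def[symmetric] by (simp add: add.commute)
  moreover have "1 / (1 + 2 * a) * (1 + 2 * t + of_nat p ^ 2 * (t * (t + 1) * B))
      = (1 + 2 * t) / (1 + 2 * a) + of_nat p ^ 2 * (t * (t + 1) / (1 + 2 * a)) * B"
    by (simp add: add_divide_distrib mult_ac)
  ultimately have "cong_pow p 3 S ((1 + 2 * t) / (1 + 2 * a) + of_nat p ^ 2 * (t * (t + 1) / (1 + 2 * a)) * B)"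
    by simp

  \<comment> \<open>Reflection and the difference equation give
    \<open>B(- a) = - B(a + 1) = - (p - 2) * a ^ (p - 3) - B(a)\<close>; Fermat turns the power into
    \<open>2 / a ^ 2\<close> modulo \<open>p\<close>.\<close>
  moreover have "cong_pow p 3 (of_nat p ^ 2 * (t * (t + 1) / (1 + 2 * a)) * B)
      (of_nat p ^ 2 * (t * (t + 1) / (1 + 2 * a)) * (2 / a\<^sup>2 - bernpoly (p - 2) a))"
  proof -
    have "odd p" using p prime prime_odd_nat by auto
    then have "B = - bernpoly (p - 2) (a + 1)"
      unfolding B_def bernpoly_reflect using p by simp
    moreover have "bernpoly (p - 2) (a + 1) - bernpoly (p - 2) a = of_nat (p - 2) * a ^ (p - 3)"
      using bernpoly_diff[of "p - 2" a] p by (simp add: numeral_3_eq_3)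
    ultimately have "B = - of_nat (p - 2) * a ^ (p - 3) - bernpoly (p - 2) a"
      by (simp only: minus_mult_left[symmetric])
    with cong_inverse_square[OF prime a a0 p]
    have "cong_pow p 1 B (2 / a\<^sup>2 - bernpoly (p - 2) a)"
      using cong_pow_diff[OF prime _ cong_pow_refl[OF prime]] by simp
    then have "cong_pow p (2 + 1) (of_nat p ^ 2 * (t * (t + 1) / (1 + 2 * a) * B))
        (of_nat p ^ 2 * (t * (t + 1) / (1 + 2 * a) * (2 / a\<^sup>2 - bernpoly (p - 2) a)))"
      by (intro cong_pow_scale cong_pow_cmult prime c)
    then show ?thesis by (simp add: mult.assoc)
  qed
  ultimately show ?thesis
    unfolding S_def B_def using cong_pow_add[OF prime cong_pow_refl[OF prime]] by blast
qed

end
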